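(* Let $a,b>0$ be real parameters, let $k\in\mathbb{Z}$, and let $x>0$ if $k\ge 1$, and $x>|k|+1$ if $k\le 0$. Then the function $s\mapsto \xi_k(s,x;a,b)$ has an analytic continuation to an entire function on the whole complex $s$-plane, and for any positive integer $n$, $$\xi_k(-n,x;a,b)=(-1)^n B^{(k)}_n(-x;a,b).$$
   Context: For $k\in\mathbb{Z}$, ${\rm Li}_k(z)=\sum_{m=1}^{\infty} z^m/m^k$. The generalized poly-Bernoulli polynomials $B^{(k)}_n(x;a,b)$ with parameters $a,b$ are defined by $$\frac{{\rm Li}_k(1-(ab)^{-t})}{b^t-a^{-t}}\,e^{xt}=\sum_{n=0}^{\infty}B^{(k)}_n(x;a,b)\frac{t^n}{n!}.$$ The generalized Arakawa-Kaneko zeta function with parameters $a,b$ is given by $$\xi_k(s,x;a,b)=\frac{1}{\Gamma(s)}\int_{0}^{\infty}\frac{{\rm Li}_k(1-(ab)^{-t})}{b^t-a^{-t}}\,e^{-xt}\,t^{s-1}\,dt;$$ it is defined for ${\rm Re}(s)>0$ and $x>0$ if $k\ge 1$, and for ${\rm Re}(s)>0$ and $x>|k|+1$ if $k\le 0$.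
   Formalization: Added so that the series for Li_k and the integral defining ξ_k converge: ab>1; x+ln b>0 if k≥1; x+ln b>(|k|+1)ln(ab) if k≤0. Without them ξ_k is undefined, e.g. for k=1, a=e^2, b=1/e, x=1/2 the integral diverges for all Re(s)>0. *)

theory Defs
  imports "HOL-Complex_Analysis.Complex_Analysis"
begin

definition polylog :: "int \<Rightarrow> 'a \<Rightarrow> 'a :: real_normed_field" where
  "polylog k z = (\<Sum>m. z ^ Suc m / of_nat (Suc m) powi k)"

definition polylog_fps :: "int \<Rightarrow> 'a :: field_char_0 fps" where
  "polylog_fps k = Abs_fps (\<lambda>m. if m = 0 then 0 else 1 / of_nat m powi k)"

text \<open>
  The generating function of the generalized poly-Bernoulli polynomials, read as a formal power
  series in \<open>t\<close> with \<open>c\<^sup>t = exp (t * ln c)\<close>. For \<open>a * b \<noteq> 1\<close> the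
  denominator has a simple zero at \<open>t = 0\<close> which is cancelled by that of the numerator;
  see \<open>poly_bernoulli_gf_mult\<close> below.
\<close>

definition poly_bernoulli_gf :: "int \<Rightarrow> real \<Rightarrow> real \<Rightarrow> real \<Rightarrow> real fps" where
  "poly_bernoulli_gf k x a b =
     (polylog_fps k oo (1 - fps_exp (- ln (a * b)))) / (fps_exp (ln b) - fps_exp (- ln a))
       * fps_exp x"

definition poly_bernoulli :: "int \<Rightarrow> nat \<Rightarrow> real \<Rightarrow> real \<Rightarrow> real \<Rightarrow> real" where
  "poly_bernoulli k n x a b = fact n * fps_nth (poly_bernoulli_gf k x a b) n"

lemma poly_bernoulli_gf_mult:
  assumes "a > 0" "b > 0" "a * b \<noteq> 1"
  shows "poly_bernoulli_gf k x a b * (fps_exp (ln b) - fps_exp (- ln a)) =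
         (polylog_fps k oo (1 - fps_exp (- ln (a * b)))) * fps_exp x"
proof -
  define D where "D = fps_exp (ln b) - fps_exp (- ln a)"
  define N where "N = (polylog_fps k oo (1 - fps_exp (- ln (a * b))) :: real fps)"
  have "ln (a * b) \<noteq> 0"
    using assms by (subst ln_eq_zero_iff) (auto intro: mult_pos_pos)
  hence nz: "ln b + ln a \<noteq> 0"
    using assms by (simp add: ln_mult add.commute)
  have D1: "fps_nth D 1 = ln b + ln a" by (simp add: D_def)
  hence "D \<noteq> 0" using nz by auto
  have "subdegree D \<le> 1" using D1 nz by (intro subdegree_leI) auto
  moreover have "fps_nth N 0 = 0"
    by (simp add: N_def fps_compose_nth_0 polylog_fps_def)
  hence "N = 0 \<or> subdegree N \<ge> 1"
    by (metis One_nat_def Suc_leI bot_nat_0.not_eq_extremum nth_subdegree_nonzero)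
  ultimately have "D dvd N"
    using \<open>D \<noteq> 0\<close> by (cases "N = 0") (auto simp: fps_dvd_iff)
  hence "N / D * D = N" by simp
  thus ?thesis
    unfolding poly_bernoulli_gf_def D_def [symmetric] N_def [symmetric]
    by (simp add: mult_ac)
qed

definition arakawa_kaneko_integrand ::
    "int \<Rightarrow> complex \<Rightarrow> real \<Rightarrow> real \<Rightarrow> real \<Rightarrow> real \<Rightarrow> complex" where
  "arakawa_kaneko_integrand k s x a b t =
     of_real (polylog k (1 - (a * b) powr (- t)) / (b powr t - a powr (- t)) * exp (- x * t))
       * of_real t powr (s - 1)"

definition arakawa_kaneko_zeta ::
    "int \<Rightarrow> complex \<Rightarrow> real \<Rightarrow> real \<Rightarrow> real \<Rightarrow> complex" where
  "arakawa_kaneko_zeta k s x a b =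
     1 / Gamma s * (LBINT t:{0<..}. arakawa_kaneko_integrand k s x a b t)"

text \<open>
  The value \<open>arakawa_kaneko_zeta k s x a b\<close> is meaningful only where the defining series and integral
  converge. For \<open>a, b > 0\<close> and \<open>Re s > 0\<close> this is exactly the following range:

  \<^item> \<open>a * b > 1\<close>. Then \<open>1 - (a * b) powr (- t)\<close> stays in \<open>(0, 1)\<close> for all \<open>t > 0\<close>. For
    \<open>a * b = 1\<close> the quotient is \<open>0 / 0\<close>, and for \<open>a * b < 1\<close> the polylogarithm series
    diverges for large \<open>t\<close>.
  \<^item> \<open>x + ln b > 0\<close> if \<open>k \<ge> 1\<close>, and \<open>x + ln b > (\<bar>k\<bar> + 1) * ln (a * b)\<close> if \<open>k \<le> 0\<close>.
    Indeed \<open>b powr t - a powr (- t) = b powr t * (1 - (a * b) powr (- t))\<close>, and as \<open>z\<close> tends to 1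
    from below, \<open>polylog k z\<close> grows at most logarithmically for \<open>k \<ge> 1\<close>, and like
    \<open>fact \<bar>k\<bar> / (1 - z) ^ (\<bar>k\<bar> + 1)\<close> for \<open>k \<le> 0\<close>.

  In the classical case \<open>a = exp 1\<close>, \<open>b = 1\<close>, and more generally if \<open>b \<ge> 1\<close> and
  \<open>1 < a * b \<le> exp 1\<close>, the last conditions follow from \<open>x > 0\<close> and \<open>x > \<bar>k\<bar> + 1\<close>, respectively.
\<close>

end

theory Submission
  imports Defs "HOL-Real_Asymp.Real_Asymp"
begin

text \<open>
  With \<open>y = x + ln b\<close>, \<open>c = ln (a * b)\<close> and \<open>g z = polylog k z / z\<close>, the integrand is
  \<open>F t * t powr (s - 1)\<close> for \<open>F t = exp (- y * t) * g (1 - exp (- c * t))\<close>. This \<open>F\<close> decays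
  exponentially, and near \<open>0\<close> its power series is the generating function of the poly-Bernoulli
  polynomials. On a short interval \<open>{0<..<r}\<close> that series can be integrated term by term, which
  produces simple poles at \<open>s = - n\<close>; each of them cancels against a zero of \<open>rGamma = 1 / Gamma\<close> and
  leaves the value \<open>(- 1) ^ n * fact n\<close> times the \<open>n\<close>-th coefficient. The integral over \<open>{r..}\<close> is
  entire in \<open>s\<close>, and \<open>rGamma\<close> annihilates it at \<open>s = - n\<close>.
\<close>

section \<open>Integrals of complex powers over a short interval at 0\<close>

lemma set_integrable_lborelI:
  fixes f :: "real \<Rightarrow> 'a::euclidean_space"
  assumes "set_integrable lebesgue A f" "continuous_on A f" "A \<in> sets borel"
  shows "set_integrable lborel A f"
proof -
  \<comment> \<open>Continuity supplies Borel measurability; for such functions integrability does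
    not change under completion of the measure.\<close>
  have "(\<lambda>x. indicator A x *\<^sub>R f x) \<in> borel_measurable lborel"
    using set_measurable_continuous_on[OF assms(3,2)] by (simp add: set_borel_measurable_def)
  with assms(1) show ?thesis
    unfolding set_integrable_def by (simp add: integrable_completion)
qed

lemma norm_of_real_powr:
  "t > 0 \<Longrightarrow> norm (complex_of_real t powr w) = t powr Re w"
  by (simp add: norm_powr_real_powr)

text \<open>Used with \<open>w = s + of_nat n\<close>: the value produces the simple pole at
  \<open>s = - n\<close>, and the integral of the norm controls the interchange of sum and
  integral.\<close>

lemma powr_set_integral_near_0:
  fixes w :: complex and r :: real
  assumes "Re w > 0" "r > 0"
  shows "set_integrable lborel {0<..<r} (\<lambda>t. complex_of_real t powr (w - 1))"
    and "(LBINT t:{0<..<r}. complex_of_real t powr (w - 1)) = of_real r powr w / w"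
    and "(LBINT t:{0<..<r}. norm (complex_of_real t powr (w - 1))) = r powr Re w / Re w"
proof -
  have real_int: "((\<lambda>t. t powr (Re w - 1)) has_integral (r powr Re w / Re w)) {0..r}"
    using has_integral_powr_from_0[of "Re w - 1" r] assms by simp
  hence "(\<lambda>t. t powr (Re w - 1)) absolutely_integrable_on {0..r}"
    by (intro nonnegative_absolutely_integrable_1) (auto simp: integrable_on_def)
  hence "(\<lambda>t. t powr (Re w - 1)) absolutely_integrable_on {0<..<r}"
    by (rule set_integrable_subset) auto
  hence re: "set_integrable lborel {0<..<r} (\<lambda>t. t powr (Re w - 1))"
    by (rule set_integrable_lborelI) (auto intro!: continuous_intros)
  show int: "set_integrable lborel {0<..<r} (\<lambda>t. complex_of_real t powr (w - 1))"
  proof (rule set_integrable_bound[OF re])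
    have "continuous_on {0<..<r} (\<lambda>t. complex_of_real t powr (w - 1))"
      by (intro continuous_intros) auto
    thus "set_borel_measurable lborel {0<..<r} (\<lambda>t. complex_of_real t powr (w - 1))"
      using set_measurable_continuous_on[of "{0<..<r}"] by (simp add: set_borel_measurable_def)
  qed (auto simp: norm_of_real_powr)
  \<comment> \<open>The antiderivative \<open>t powr w / w\<close> is continuous up to 0 because
    \<open>Re w > 0\<close>, and there it takes the value \<open>0 powr w = 0\<close>.\<close>
  have "((\<lambda>t. complex_of_real t powr (w - 1)) has_integral
           (of_real r powr w / w - of_real 0 powr w / w)) {0..r}"
  proof (rule fundamental_theorem_of_calculus_interior)
    show "continuous_on {0..r} (\<lambda>t. complex_of_real t powr w / w)"
      using assms by (intro continuous_intros) auto
    fix t assume t: "t \<in> {0<..<r}"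
    have "((\<lambda>z. z powr w / w) has_field_derivative (of_real t powr (w - 1))) (at (complex_of_real t))"
      using t assms by (auto intro!: derivative_eq_intros simp: complex_nonpos_Reals_iff)
    thus "((\<lambda>t. complex_of_real t powr w / w) has_vector_derivative (of_real t powr (w - 1))) (at t)"
      using has_vector_derivative_real_field by blast
  qed (use assms in auto)
  thus "(LBINT t:{0<..<r}. complex_of_real t powr (w - 1)) = of_real r powr w / w"
    using set_borel_integral_eq_integral(2)[OF int] by (simp add: has_integral_Icc_iff_Ioo integral_unique)
  have "(LBINT t:{0<..<r}. norm (complex_of_real t powr (w - 1))) = (LBINT t:{0<..<r}. t powr (Re w - 1))"
    by (rule set_lebesgue_integral_cong) (auto simp: norm_of_real_powr)
  also have "\<dots> = r powr Re w / Re w"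
    using set_borel_integral_eq_integral(2)[OF re] real_int
    by (simp add: has_integral_Icc_iff_Ioo integral_unique)
  finally show "(LBINT t:{0<..<r}. norm (complex_of_real t powr (w - 1))) = r powr Re w / Re w" .
qed

section \<open>Division of the reciprocal Gamma function by its zeros\<close>

text \<open>The value at \<open>s = - n\<close> is the derivative of \<open>rGamma\<close> there.\<close>

definition rGamma_quot :: "nat \<Rightarrow> complex \<Rightarrow> complex" where
  "rGamma_quot n s = (if s = - of_nat n then (- 1) ^ n * fact n else rGamma s / (s + of_nat n))"

text \<open>The function is the difference quotient of the entire function \<open>rGamma\<close> at
  its zero \<open>- n\<close>, so the singularity is removable.\<close>

lemma rGamma_quot_holomorphic: "rGamma_quot n holomorphic_on UNIV"
proof -
  have d: "deriv rGamma (- of_nat n) = ((- 1) ^ n * fact n :: complex)"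
    by (intro DERIV_imp_deriv derivative_intros)
  have "(\<lambda>z::complex. if z = - of_nat n then deriv rGamma (- of_nat n)
          else (rGamma z - rGamma (- of_nat n)) / (z - - of_nat n)) holomorphic_on UNIV"
    by (rule pole_lemma_open) (auto intro!: holomorphic_rGamma)
  thus ?thesis
    unfolding d by (rule holomorphic_transform) (auto simp: rGamma_quot_def)
qed

lemma rGamma_quot_minus_of_nat:
  "rGamma_quot n (- of_nat m) = (if m = n then (- 1) ^ n * fact n else 0)"
  by (auto simp: rGamma_quot_def)

text \<open>Weierstrass M-test on each closed unit disc. Finitely many terms do not affect
  convergence, so only those \<open>n\<close> matter for which \<open>- n\<close> is far from the
  disc.\<close>

lemma rGamma_quot_series_holomorphic:
  assumes "summable (\<lambda>n. norm (c n))"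
  shows "(\<lambda>s. \<Sum>n. c n * rGamma_quot n s) holomorphic_on UNIV"
proof (rule holomorphic_uniform_sequence)
  show "(\<lambda>s. \<Sum>n<N. c n * rGamma_quot n s) holomorphic_on UNIV" for N
    by (intro holomorphic_intros rGamma_quot_holomorphic)
  fix z :: complex
  have "bounded (rGamma ` cball z 1)"
    by (intro compact_imp_bounded compact_continuous_image holomorphic_on_imp_continuous_on
          holomorphic_rGamma) auto
  then obtain B where B: "\<And>s. s \<in> cball z 1 \<Longrightarrow> norm (rGamma s) \<le> B"
    unfolding bounded_iff by blast
  have B0: "B \<ge> 0" using order_trans[OF norm_ge_zero B[of z]] by simp
  \<comment> \<open>For \<open>n\<close> beyond \<open>norm z + 2\<close> every \<open>s\<close> in
    the disc has distance at least 1 from \<open>- n\<close>, so the division does not enlarge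
    \<open>rGamma s\<close>.\<close>
  have *: "norm (c n * rGamma_quot n s) \<le> norm (c n) * B"
    if n: "real n \<ge> norm z + 2" and s: "s \<in> cball z 1" for n s
  proof -
    have "norm s \<le> norm z + 1"
      using s norm_triangle_sub[of s z] by (simp add: dist_norm norm_minus_commute)
    hence ge: "norm (s + of_nat n) \<ge> 1"
      using n norm_diff_ineq[of "of_nat n" s] by (simp add: add.commute)
    hence "s \<noteq> - of_nat n" by auto
    hence "norm (rGamma_quot n s) = norm (rGamma s) / norm (s + of_nat n)"
      by (simp add: rGamma_quot_def norm_divide)
    also have "\<dots> \<le> B / 1"
      using B[OF s] ge B0 by (intro frac_le) auto
    finally show ?thesis by (simp add: norm_mult mult_left_mono)
  qed
  have "uniform_limit (cball z 1) (\<lambda>N s. \<Sum>n<N. c n * rGamma_quot n s)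
          (\<lambda>s. \<Sum>n. c n * rGamma_quot n s) sequentially"
  proof (rule Weierstrass_m_test_ev)
    have "eventually (\<lambda>n. real n \<ge> norm z + 2) sequentially"
      using filterlim_real_sequentially by (simp add: filterlim_at_top)
    thus "\<forall>\<^sub>F n in sequentially. \<forall>s\<in>cball z 1. norm (c n * rGamma_quot n s) \<le> norm (c n) * B"
      by eventually_elim (use * in blast)
  qed (use assms in \<open>auto intro: summable_mult2\<close>)
  thus "\<exists>d>0. cball z d \<subseteq> UNIV \<and> uniform_limit (cball z d) (\<lambda>N s. \<Sum>n<N. c n * rGamma_quot n s)
          (\<lambda>s. \<Sum>n. c n * rGamma_quot n s) sequentially"
    by (intro exI[of _ 1]) auto
qed auto

text \<open>The integrand is the norm of the integrand of Euler's integral for Gamma at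
  \<open>\<sigma>\<close>, rescaled by \<open>\<epsilon>\<close>.\<close>

lemma exp_powr_set_integrable:
  assumes "\<sigma> > 0" "\<epsilon> > 0"
  shows "set_integrable lborel {0<..} (\<lambda>t::real. exp (- \<epsilon> * t) * t powr (\<sigma> - 1))"
proof -
  have "(\<lambda>t. complex_of_real t powr (of_real \<sigma> - 1) / of_real (exp (\<epsilon> * t))) absolutely_integrable_on {0<..}"
    using assms by (intro absolutely_integrable_Gamma_integral) auto
  hence "(\<lambda>t. norm (complex_of_real t powr (of_real \<sigma> - 1) / of_real (exp (\<epsilon> * t)))) absolutely_integrable_on {0<..}"
    by (rule set_integrable_norm)
  also have "?this \<longleftrightarrow> (\<lambda>t::real. exp (- \<epsilon> * t) * t powr (\<sigma> - 1)) absolutely_integrable_on {0<..}"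
    by (rule set_integrable_cong)
       (auto simp: norm_divide norm_of_real_powr exp_minus field_simps)
  finally show ?thesis
    by (rule set_integrable_lborelI) (auto intro!: continuous_intros)
qed

subsection \<open>Continuation of Mellin transforms\<close>

text \<open>\<open>F\<close> is the kernel of the Mellin transform. Absolute summability at the end
  point \<open>r\<close> itself makes termwise integration over all of \<open>{0<..<r}\<close>
  possible.\<close>

locale mellin =
  fixes F :: "real \<Rightarrow> complex" and f :: "nat \<Rightarrow> complex" and C \<epsilon> r :: real
  assumes cont: "continuous_on {0<..} F"
    and eps: "\<epsilon> > 0" and decay: "\<And>t. t > 0 \<Longrightarrow> norm (F t) \<le> C * exp (- \<epsilon> * t)"
    and r: "r > 0" and expansion: "\<And>t. 0 < t \<Longrightarrow> t < r \<Longrightarrow> (\<lambda>n. f n * of_real t ^ n) sums F t"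
    and summable: "summable (\<lambda>n. norm (f n) * r ^ n)"
begin

lemma integrand_bound:
  assumes "t > 0"
  shows "norm (F t * of_real t powr (s - 1)) \<le> C * (exp (- \<epsilon> * t) * t powr (Re s - 1))"
  using mult_right_mono[OF decay[OF assms], of "t powr (Re s - 1)"] assms
  by (simp add: norm_mult norm_of_real_powr mult_ac)

lemma C_nonneg: "C \<ge> 0"
  using order_trans[OF norm_ge_zero decay[of 1]] by (simp add: zero_le_mult_iff)

lemma integrand_continuous:
  "A \<subseteq> {0<..} \<Longrightarrow> continuous_on A (\<lambda>t. F t * of_real t powr (s - 1))"
  by (intro continuous_intros continuous_on_subset[OF cont]) auto

lemma integrand_measurable:
  assumes "A \<subseteq> {0<..}" "A \<in> sets borel"
  shows "set_borel_measurable lborel A (\<lambda>t. F t * of_real t powr (s - 1))"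
  using set_measurable_continuous_on[OF assms(2) integrand_continuous[OF assms(1)]]
  by (simp add: set_borel_measurable_def)

lemma integrand_integrable:
  assumes "Re s > 0"
  shows "set_integrable lborel {0<..} (\<lambda>t. F t * of_real t powr (s - 1))"
proof (rule set_integrable_bound)
  show "set_integrable lborel {0<..} (\<lambda>t. C * (exp (- \<epsilon> * t) * t powr (Re s - 1)))"
    using exp_powr_set_integrable[OF assms eps] by simp
  show "set_borel_measurable lborel {0<..} (\<lambda>t. F t * of_real t powr (s - 1))"
    by (rule integrand_measurable) auto
  show "AE t in lborel. t \<in> {0<..} \<longrightarrow> norm (F t * of_real t powr (s - 1))
          \<le> norm (C * (exp (- \<epsilon> * t) * t powr (Re s - 1)))"
    using integrand_bound[of _ s] by (auto simp del: norm_mult intro!: order_trans[OF _ abs_ge_self])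
qed

text \<open>Away from 0 the size of \<open>Re s\<close> is irrelevant: the exponent is raised to
  \<open>\<sigma> = max (Re s) 1\<close>, where the integral converges, at the cost of the constant
  factor \<open>q powr (Re s - \<sigma>)\<close>.\<close>

lemma integrand_integrable_away_from_0:
  assumes "q > 0"
  shows "set_integrable lborel {q..} (\<lambda>t. F t * of_real t powr (s - 1))"
proof (rule set_integrable_bound)
  define \<sigma> where "\<sigma> = max (Re s) 1"
  have "set_integrable lborel {0<..} (\<lambda>t. F t * of_real t powr (of_real \<sigma> - 1))"
    by (rule integrand_integrable) (auto simp: \<sigma>_def)
  hence "set_integrable lborel {q..} (\<lambda>t. F t * of_real t powr (of_real \<sigma> - 1))"
    by (rule set_integrable_subset) (use assms in auto)
  thus "set_integrable lborel {q..}
          (\<lambda>t. of_real (q powr (Re s - \<sigma>)) * (F t * of_real t powr (of_real \<sigma> - 1)))"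
    by simp
  show "set_borel_measurable lborel {q..} (\<lambda>t. F t * of_real t powr (s - 1))"
    using assms by (intro integrand_measurable) auto
  have "norm (F t * of_real t powr (s - 1)) \<le>
          norm (of_real (q powr (Re s - \<sigma>)) * (F t * of_real t powr (of_real \<sigma> - 1)))"
    if "t \<ge> q" for t
  proof -
    have "t powr (Re s - 1) = t powr (Re s - \<sigma>) * t powr (\<sigma> - 1)"
      by (simp flip: powr_add)
    also have "\<dots> \<le> q powr (Re s - \<sigma>) * t powr (\<sigma> - 1)"
      using that assms by (intro mult_right_mono powr_mono2') (auto simp: \<sigma>_def)
    finally have "norm (F t) * t powr (Re s - 1) \<le> norm (F t) * (q powr (Re s - \<sigma>) * t powr (\<sigma> - 1))"
      by (rule mult_left_mono) auto
    thus ?thesis using that assms by (simp add: norm_mult norm_of_real_powr mult_ac)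
  qed
  thus "AE t in lborel. t \<in> {q..} \<longrightarrow> norm (F t * of_real t powr (s - 1)) \<le>
          norm (of_real (q powr (Re s - \<sigma>)) * (F t * of_real t powr (of_real \<sigma> - 1)))"
    by auto
qed

section \<open>The integral away from 0 as an entire function\<close>

definition tail :: "complex \<Rightarrow> complex" where
  "tail s = (LBINT t:{r..}. F t * of_real t powr (s - 1))"

text \<open>Differentiation under the integral sign; on a compact interval inside
  \<open>{0<..}\<close> the integrand and its derivative in \<open>s\<close> are jointly
  continuous.\<close>

lemma integral_Icc_holomorphic:
  "(\<lambda>s. LBINT t:{r..u}. F t * of_real t powr (s - 1)) holomorphic_on UNIV"
proof -
  have "(\<lambda>s. integral (cbox r u) (\<lambda>t. F t * of_real t powr (s - 1))) holomorphic_on UNIV"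
  proof (rule leibniz_rule_holomorphic)
    show "((\<lambda>s. F t * of_real t powr (s - 1)) has_field_derivative
             F t * (Ln (of_real t) * of_real t powr (s - 1))) (at s within UNIV)"
      if "t \<in> cbox r u" for s t
      using that r by (auto intro!: derivative_eq_intros DERIV_chain'[OF _ has_field_derivative_powr_right]
                            simp: mult_ac)
    show "(\<lambda>t. F t * of_real t powr (s - 1)) integrable_on cbox r u" for s
      using r by (intro integrable_continuous integrand_continuous) auto
    have "continuous_on (UNIV \<times> cbox r u) (\<lambda>p. F (snd p))"
      using r by (intro continuous_on_compose2[OF cont] continuous_intros) auto
    moreover have "continuous_on (UNIV \<times> cbox r u)
                     (\<lambda>p. Ln (of_real (snd p)) * of_real (snd p) powr (fst p - 1))"
      using r by (intro continuous_intros) (auto simp: complex_nonpos_Reals_iff)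
    ultimately show "continuous_on (UNIV \<times> cbox r u)
                 (\<lambda>(s, t). F t * (Ln (of_real t) * of_real t powr (s - 1)))"
      unfolding case_prod_unfold by (rule continuous_on_mult)
  qed auto
  moreover have "integral (cbox r u) (\<lambda>t. F t * of_real t powr (s - 1)) =
                   (LBINT t:{r..u}. F t * of_real t powr (s - 1))" for s
  proof -
    have "set_integrable lborel {r..u} (\<lambda>t. F t * of_real t powr (s - 1))"
      by (rule set_integrable_subset[OF integrand_integrable_away_from_0[OF r]]) auto
    thus ?thesis using set_borel_integral_eq_integral(2) by fastforce
  qed
  ultimately show ?thesis by simp
qed

text \<open>The integrals over \<open>{r..real n}\<close> converge to \<open>tail\<close> uniformly
  on unit discs, since one function \<open>D\<close> dominates the integrand for all
  \<open>s\<close> in the disc.\<close>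

lemma tail_holomorphic: "tail holomorphic_on UNIV"
proof (rule holomorphic_uniform_sequence)
  fix z :: complex
  \<comment> \<open>On the disc \<open>Re s - 1 \<le> Re z < R\<close>. The exponent of
    \<open>D\<close> is written \<open>(R + 1) - 1\<close> to fit the Gamma integral with the
    positive parameter \<open>R + 1\<close>.\<close>
  define R where "R = max 0 (Re z) + 1"
  define D where "D = (\<lambda>t. C * (exp (- \<epsilon> * t) * t powr ((R + 1) - 1)))"
  have Dint: "set_integrable lborel {0<..} D"
    using exp_powr_set_integrable[of "R + 1" \<epsilon>] eps by (simp add: D_def R_def)
  \<comment> \<open>Beyond 1 the power \<open>t powr e\<close> increases with \<open>e\<close>, so
    exponents can be compared there.\<close>
  define q where "q = max 1 r"
  have Dint': "set_integrable lborel A D" if "A \<subseteq> {0<..}" "A \<in> sets lborel" for A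
    using set_integrable_subset[OF Dint] that by blast
  have "((\<lambda>u. LBINT t:{q..u}. D t) \<longlongrightarrow> (LBINT t:{q..}. D t)) at_top"
    by (intro tendsto_set_lebesgue_integral_at_top Dint') (auto simp: q_def)
  hence "(\<lambda>n. LBINT t:{q..real n}. D t) \<longlonglongrightarrow> (LBINT t:{q..}. D t)"
    using filterlim_compose filterlim_real_sequentially by blast
  hence Dlim: "(\<lambda>n. (LBINT t:{q..}. D t) - (LBINT t:{q..real n}. D t)) \<longlonglongrightarrow> 0"
    using tendsto_diff[OF tendsto_const[of "LBINT t:{q..}. D t"]] by fastforce
  have bound: "norm ((LBINT t:{r..real n}. F t * of_real t powr (s - 1)) - tail s) \<le>
                 (LBINT t:{q..}. D t) - (LBINT t:{q..real n}. D t)"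
    if s: "s \<in> cball z 1" and n: "real n \<ge> q" for s n
  proof -
    let ?g = "\<lambda>t. F t * of_real t powr (s - 1)"
    have pos: "{real n<..} \<subseteq> {0<..}" "{q..real n} \<subseteq> {0<..}" by (auto simp: q_def)
    have int: "set_integrable lborel {r..} ?g"
      by (rule integrand_integrable_away_from_0[OF r])
    have int': "set_integrable lborel {real n<..} ?g"
      using n by (intro set_integrable_subset[OF int]) (auto simp: q_def)
    have "{r..} = {r..real n} \<union> {real n<..}" using n by (auto simp: q_def)
    moreover have "(LBINT t:{r..real n}\<union>{real n<..}. ?g t) =
                      (LBINT t:{r..real n}. ?g t) + (LBINT t:{real n<..}. ?g t)"
      by (intro set_integral_Un int' set_integrable_subset[OF int]) auto
    ultimately have "norm ((LBINT t:{r..real n}. ?g t) - tail s) = norm (LBINT t:{real n<..}. ?g t)"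
      by (simp add: tail_def)
    also have "\<dots> \<le> (LBINT t:{real n<..}. norm (?g t))"
      by (rule set_integral_norm_bound[OF int'])
    also have "\<dots> \<le> (LBINT t:{real n<..}. D t)"
    proof (intro set_integral_mono set_integrable_norm int' Dint' pos)
      fix t assume t: "t \<in> {real n<..}"
      hence t1: "t \<ge> 1" using n by (auto simp: q_def)
      have "Re s - Re z \<le> 1"
        using s complex_Re_le_cmod[of "s - z"] by (simp add: dist_norm norm_minus_commute)
      hence "t powr (Re s - 1) \<le> t powr R"
        using t1 by (intro powr_mono) (auto simp: R_def)
      hence "C * (exp (- \<epsilon> * t) * t powr (Re s - 1)) \<le> D t"
        unfolding D_def using C_nonneg by (intro mult_left_mono) auto
      thus "norm (?g t) \<le> D t"
        using integrand_bound[of t s] t1 by linarith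
    qed auto
    also have "\<dots> = (LBINT t:{q..}. D t) - (LBINT t:{q..real n}. D t)"
    proof -
      have "{q..} = {q..real n} \<union> {real n<..}" using n by auto
      moreover have "(LBINT t:{q..real n}\<union>{real n<..}. D t) =
                       (LBINT t:{q..real n}. D t) + (LBINT t:{real n<..}. D t)"
        by (intro set_integral_Un Dint' pos) auto
      ultimately show ?thesis by simp
    qed
    finally show ?thesis .
  qed
  have "uniform_limit (cball z 1) (\<lambda>n s. LBINT t:{r..real n}. F t * of_real t powr (s - 1)) tail sequentially"
  proof (rule uniform_limitI)
    fix e :: real assume "e > 0"
    with Dlim have "\<forall>\<^sub>F n in sequentially. (LBINT t:{q..}. D t) - (LBINT t:{q..real n}. D t) < e"
      by (rule order_tendstoD)
    moreover have "\<forall>\<^sub>F n in sequentially. real n \<ge> q"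
      using filterlim_real_sequentially by (simp add: filterlim_at_top)
    ultimately show "\<forall>\<^sub>F n in sequentially. \<forall>s\<in>cball z 1.
        dist (LBINT t:{r..real n}. F t * of_real t powr (s - 1)) (tail s) < e"
    proof eventually_elim
      case (elim n)
      thus ?case using bound[of _ n] unfolding dist_norm by (meson le_less_trans)
    qed
  qed
  thus "\<exists>d>0. cball z d \<subseteq> UNIV \<and>
      uniform_limit (cball z d) (\<lambda>n s. LBINT t:{r..real n}. F t * of_real t powr (s - 1)) tail sequentially"
    by (intro exI[of _ 1]) auto
qed (auto intro: integral_Icc_holomorphic)

section \<open>Termwise integration near 0 and the continuation\<close>

lemma integral_near_0_sums:
  assumes "Re s > 0"
  shows "(\<lambda>n. f n * of_real r ^ n * of_real r powr s / (s + of_nat n)) sums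
           (LBINT t:{0<..<r}. F t * of_real t powr (s - 1))"
proof -
  let ?h = "\<lambda>n t. f n * complex_of_real t powr ((s + of_nat n) - 1)"
  let ?H = "\<lambda>n t. indicator {0<..<r} t *\<^sub>R ?h n t"
  have Re: "Re (s + of_nat n) > 0" for n using assms by simp
  have eq: "f n * of_real t ^ n * of_real t powr (s - 1) = ?h n t" if "t > 0" for n t
  proof -
    have "of_real t powr (s - 1) * of_real t powr (of_nat n) = complex_of_real t powr ((s - 1) + of_nat n)"
      by (rule powr_add[symmetric])
    thus ?thesis using that by (simp add: algebra_simps)
  qed
  have sums: "(\<lambda>n. ?h n t) sums (F t * of_real t powr (s - 1))" if "0 < t" "t < r" for t
    using sums_mult2[OF expansion[OF that], of "of_real t powr (s - 1)"] that by (simp add: eq)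
  \<comment> \<open>The interchange needs pointwise absolute convergence and a convergent sum of the
    integrals of the norms.\<close>
  have "(\<lambda>n. integral\<^sup>L lborel (?H n)) sums (LBINT t. (\<Sum>n. ?H n t))"
  proof (rule sums_integral)
    show "integrable lborel (?H n)" for n
      using set_integrable_mult_right[OF powr_set_integral_near_0(1)[OF Re r]]
      unfolding set_integrable_def .
    have "summable (\<lambda>n. norm (?H n t))" for t
    proof (cases "t \<in> {0<..<r}")
      case True
      have "norm (f n * of_real t ^ n) \<le> norm (f n) * r ^ n" for n
        using True by (simp add: norm_mult norm_power power_mono mult_left_mono)
      hence "summable (\<lambda>n. norm (f n * of_real t ^ n))"
        using summable by (intro summable_comparison_test'[OF summable]) auto
      hence "summable (\<lambda>n. norm (f n * of_real t ^ n) * norm (complex_of_real t powr (s - 1)))"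
        by (rule summable_mult2)
      moreover have "norm (f n * of_real t ^ n) * norm (complex_of_real t powr (s - 1)) = norm (?H n t)" for n
        using True by (simp flip: eq norm_mult)
      ultimately show ?thesis by simp
    qed auto
    thus "AE t in lborel. summable (\<lambda>n. norm (?H n t))" by simp
    have "(LBINT t. norm (?H n t)) = norm (f n) * (r powr (Re s + real n) / (Re s + real n))" for n
    proof -
      have "(LBINT t. norm (?H n t)) =
              (LBINT t:{0<..<r}. norm (f n) * norm (complex_of_real t powr ((s + of_nat n) - 1)))"
        unfolding set_lebesgue_integral_def
        by (intro Bochner_Integration.integral_cong) (auto simp: norm_mult indicator_def)
      thus ?thesis using powr_set_integral_near_0(3)[OF Re r, of n] by simp
    qed
    \<comment> \<open>Replacing the denominator by the smaller \<open>Re s\<close> leaves a fixed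
      multiple of the summable \<open>norm (f n) * r ^ n\<close>.\<close>
    also have "norm (f n) * (r powr (Re s + real n) / (Re s + real n)) \<le>
                 norm (f n) * r ^ n * (r powr Re s / Re s)" for n
    proof -
      have "r powr (Re s + real n) / (Re s + real n) \<le> r powr (Re s + real n) / Re s"
        using assms by (intro divide_left_mono) auto
      also have "\<dots> = r ^ n * (r powr Re s / Re s)"
        using r by (simp add: powr_add powr_realpow)
      finally show ?thesis
        unfolding mult.assoc by (rule mult_left_mono) auto
    qed
    finally have le: "(LBINT t. norm (?H n t)) \<le> norm (f n) * r ^ n * (r powr Re s / Re s)" for n .
    show "summable (\<lambda>n. LBINT t. norm (?H n t))"
    proof (rule summable_comparison_test'[OF summable_mult2[OF summable]])
      show "norm (LBINT t. norm (?H n t)) \<le> norm (f n) * r ^ n * (r powr Re s / Re s)" for n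
        using le[of n] by (subst real_norm_def, subst abs_of_nonneg) (auto intro: integral_nonneg_AE)
    qed
  qed
  also have "(\<lambda>n. integral\<^sup>L lborel (?H n)) = (\<lambda>n. f n * of_real r ^ n * of_real r powr s / (s + of_nat n))"
  proof
    fix n
    have "integral\<^sup>L lborel (?H n) = (LBINT t:{0<..<r}. ?h n t)"
      by (simp only: set_lebesgue_integral_def)
    also have "\<dots> = f n * (of_real r powr (s + of_nat n) / (s + of_nat n))"
      using powr_set_integral_near_0(2)[OF Re r, of n] by simp
    finally show "integral\<^sup>L lborel (?H n) = f n * of_real r ^ n * of_real r powr s / (s + of_nat n)"
      using r by (simp add: powr_add mult_ac)
  qed
  also have "(LBINT t. (\<Sum>n. ?H n t)) = (LBINT t:{0<..<r}. F t * of_real t powr (s - 1))"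
    unfolding set_lebesgue_integral_def
    by (intro Bochner_Integration.integral_cong)
       (auto simp: indicator_def sums_iff dest!: sums)
  finally show ?thesis .
qed

theorem continuation:
  "\<exists>\<xi>. \<xi> holomorphic_on UNIV \<and>
    (\<forall>s. Re s > 0 \<longrightarrow> \<xi> s = rGamma s * (LBINT t:{0<..}. F t * of_real t powr (s - 1))) \<and>
    (\<forall>n. \<xi> (- of_nat n) = (- 1) ^ n * fact n * f n)"
proof (intro exI conjI allI impI)
  define c where "c = (\<lambda>n. f n * of_real r ^ n)"
  \<comment> \<open>The first summand is \<open>rGamma s\<close> times the series for the integral
    near 0, with \<open>rGamma s / (s + of_nat n)\<close> replaced by
    \<open>rGamma_quot n s\<close>, which is regular at \<open>- n\<close> as well.\<close>
  define \<xi> where "\<xi> = (\<lambda>s. of_real r powr s * (\<Sum>n. c n * rGamma_quot n s) + rGamma s * tail s)"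
  have "summable (\<lambda>n. norm (c n))"
    using summable r by (simp add: c_def norm_mult norm_power)
  thus "\<xi> holomorphic_on UNIV"
    unfolding \<xi>_def using r
    by (intro holomorphic_intros rGamma_quot_series_holomorphic tail_holomorphic) auto
  show "\<xi> s = rGamma s * (LBINT t:{0<..}. F t * of_real t powr (s - 1))" if s: "Re s > 0" for s
  proof -
    let ?g = "\<lambda>t. F t * of_real t powr (s - 1)"
    have "s \<noteq> - of_nat n" for n using s by auto
    hence "of_real r powr s * (c n * rGamma_quot n s) =
             rGamma s * (f n * of_real r ^ n * of_real r powr s / (s + of_nat n))" for n
      by (simp add: rGamma_quot_def c_def)
    hence "(\<lambda>n. of_real r powr s * (c n * rGamma_quot n s)) sums (rGamma s * (LBINT t:{0<..<r}. ?g t))"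
      using sums_mult[OF integral_near_0_sums[OF s], of "rGamma s"] by simp
    \<comment> \<open>Since \<open>of_real r powr s\<close> is nonzero, convergence of the scaled
      series gives that of the unscaled one.\<close>
    moreover have "of_real r powr s * (\<Sum>n. c n * rGamma_quot n s) =
                     (\<Sum>n. of_real r powr s * (c n * rGamma_quot n s))"
      using calculation r by (intro suminf_mult[symmetric]) (auto simp: sums_iff)
    ultimately have "of_real r powr s * (\<Sum>n. c n * rGamma_quot n s) = rGamma s * (LBINT t:{0<..<r}. ?g t)"
      by (simp only: sums_iff)
    moreover have "(LBINT t:{0<..<r}\<union>{r..}. ?g t) = (LBINT t:{0<..<r}. ?g t) + (LBINT t:{r..}. ?g t)"
      using r by (intro set_integral_Un set_integrable_subset[OF integrand_integrable[OF s]]) auto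
    moreover have "{0<..<r} \<union> {r..} = {0<..}" using r by auto
    ultimately show ?thesis by (simp add: \<xi>_def tail_def distrib_left)
  qed
  show "\<xi> (- of_nat m) = (- 1) ^ m * fact m * f m" for m
  proof -
    have "(\<lambda>n. c n * rGamma_quot n (- of_nat m)) = (\<lambda>n. if n = m then c m * ((- 1) ^ m * fact m) else 0)"
      by (auto simp: rGamma_quot_minus_of_nat)
    hence "(\<Sum>n. c n * rGamma_quot n (- of_nat m)) = c m * ((- 1) ^ m * fact m)"
      by (simp add: sums_iff[THEN iffD1, OF sums_single])
    \<comment> \<open>The factor \<open>r powr (- m)\<close> cancels the \<open>r ^ m\<close> in
      \<open>c m\<close>, and \<open>rGamma\<close> vanishes at \<open>- m\<close>.\<close>
    thus ?thesis using r by (simp add: \<xi>_def c_def powr_minus)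
  qed
qed

end

subsection \<open>Power series expansion and decay of the integrand\<close>

text \<open>
  The library has the composition rule for \<open>has_fps_expansion\<close> only over the complex numbers, so
  real power series are transported there.
\<close>

definition fps_of_real :: "real fps \<Rightarrow> 'a :: real_normed_field fps" where
  "fps_of_real f = Abs_fps (\<lambda>n. of_real (fps_nth f n))"

lemma fps_of_real_nth [simp]: "fps_nth (fps_of_real f) n = of_real (fps_nth f n)"
  by (simp add: fps_of_real_def)

lemma fps_of_real_1 [simp]: "fps_of_real 1 = 1"
  by (rule fps_ext) simp

lemma fps_of_real_diff: "fps_of_real (f - g) = fps_of_real f - fps_of_real g"
  by (rule fps_ext) simp

lemma fps_of_real_mult: "fps_of_real (f * g) = fps_of_real f * fps_of_real g"
  by (rule fps_ext) (simp add: fps_mult_nth)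

lemma fps_of_real_power: "fps_of_real (f ^ n) = fps_of_real f ^ n"
  by (induction n) (simp_all add: fps_of_real_mult)

lemma fps_of_real_compose: "fps_of_real (f oo g) = fps_of_real f oo fps_of_real g"
  by (rule fps_ext) (simp add: fps_compose_nth flip: fps_of_real_power)

lemma fps_of_real_exp: "fps_of_real (fps_exp c) = fps_exp (of_real c)"
  by (rule fps_ext) simp

section \<open>The power series of \<open>polylog k z / z\<close> and its growth as \<open>z\<close>
  tends to 1\<close>

definition polylog_quot_fps :: "int \<Rightarrow> 'a :: field_char_0 fps" where
  "polylog_quot_fps k = Abs_fps (\<lambda>m. 1 / of_nat (Suc m) powi k)"

lemma polylog_quot_fps_nth: "fps_nth (polylog_quot_fps k) m = 1 / of_nat (Suc m) powi k"
  by (simp add: polylog_quot_fps_def)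

text \<open>After substituting \<open>1 - exp (- c * t)\<close> the factor \<open>fps_X\<close>
  becomes the one that cancels the zero of the denominator at \<open>t = 0\<close>.\<close>

lemma polylog_fps_conv_quot: "polylog_fps k = fps_X * polylog_quot_fps k"
  by (rule fps_ext) (auto simp: polylog_fps_def polylog_quot_fps_nth)

lemma fps_of_real_polylog_quot: "fps_of_real (polylog_quot_fps k) = polylog_quot_fps k"
  by (rule fps_ext) (simp add: polylog_quot_fps_nth of_real_power_int del: of_nat_Suc)

text \<open>Ratio test: consecutive coefficients have quotient
  \<open>((m + 2) / (m + 1)) powi k\<close>, which tends to 1 whatever the sign of
  \<open>k\<close>.\<close>

lemma conv_radius_polylog_quot:
  "fps_conv_radius (polylog_quot_fps k :: 'a :: {banach, real_normed_field} fps) = 1"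
  unfolding fps_conv_radius_def
proof (rule conv_radius_ratio_limit_nonzero)
  have "(\<lambda>m. (real (m + 2) / real (m + 1)) powi k) \<longlonglongrightarrow> 1 powi k"
  proof (intro tendsto_power_int)
    show "(\<lambda>m. real (m + 2) / real (m + 1)) \<longlonglongrightarrow> 1" by real_asymp
  qed auto
  also have "(\<lambda>m. (real (m + 2) / real (m + 1)) powi k) =
     (\<lambda>m. norm (fps_nth (polylog_quot_fps k :: 'a fps) m) / norm (fps_nth (polylog_quot_fps k :: 'a fps) (Suc m)))"
    by (simp add: polylog_quot_fps_nth fun_eq_iff norm_divide norm_power_int power_int_divide_distrib
             del: of_nat_Suc of_nat_add)
  finally show "\<dots> \<longlonglongrightarrow> 1" by simp
qed (auto simp: polylog_quot_fps_nth simp del: of_nat_Suc)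

lemma polylog_quot_sums:
  fixes z :: "'a :: {banach, real_normed_field}"
  assumes "norm z < 1"
  shows "(\<lambda>m. z ^ m / of_nat (Suc m) powi k) sums eval_fps (polylog_quot_fps k) z"
  using sums_eval_fps[of z "polylog_quot_fps k :: 'a fps"] assms
  by (simp add: conv_radius_polylog_quot polylog_quot_fps_nth del: of_nat_Suc)

lemma polylog_conv_quot:
  fixes z :: "'a :: {banach, real_normed_field}"
  assumes "norm z < 1"
  shows "polylog k z = z * eval_fps (polylog_quot_fps k) z"
  using sums_mult[OF polylog_quot_sums[OF assms], of z k] by (simp add: polylog_def sums_iff)

lemma eval_polylog_quot_of_real:
  assumes "\<bar>z\<bar> < 1"
  shows "eval_fps (polylog_quot_fps k) (complex_of_real z) = of_real (eval_fps (polylog_quot_fps k) z)"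
proof -
  have "(\<lambda>m. complex_of_real z ^ m / of_nat (Suc m) powi k) sums of_real (eval_fps (polylog_quot_fps k) z)"
    using sums_of_real[where 'a = complex, OF polylog_quot_sums[of z k]] assms
    by (simp add: of_real_power_int del: of_nat_Suc)
  moreover have "(\<lambda>m. complex_of_real z ^ m / of_nat (Suc m) powi k) sums
                   eval_fps (polylog_quot_fps k) (complex_of_real z)"
    using assms by (intro polylog_quot_sums) simp
  ultimately show ?thesis by (rule sums_unique2[symmetric])
qed

lemma eval_polylog_quot_nonneg: "0 \<le> z \<Longrightarrow> z < 1 \<Longrightarrow> eval_fps (polylog_quot_fps k) (z :: real) \<ge> 0"
  by (rule sums_le[OF _ sums_zero polylog_quot_sums]) auto

text \<open>For \<open>k \<ge> 1\<close> each coefficient is at most the one for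
  \<open>k = 1\<close>, where the series is logarithmic.\<close>

lemma eval_polylog_quot_le_ln:
  fixes z :: real
  assumes "k \<ge> 1" "0 < z" "z < 1"
  shows "eval_fps (polylog_quot_fps k) z \<le> - ln (1 - z) / z"
proof (rule sums_le)
  show "(\<lambda>m. z ^ m / real (Suc m) powi k) sums eval_fps (polylog_quot_fps k) z"
    using polylog_quot_sums[of z k] assms by simp
  have "(\<lambda>n. - (z ^ n) / real n) sums ln (1 - z)"
    using ln_series'[of "- z"] assms by simp
  hence "(\<lambda>n. - (z ^ Suc n) / real (Suc n)) sums ln (1 - z)"
    by (subst sums_Suc_iff) simp
  from sums_divide[OF sums_minus[OF this], of z]
  show "(\<lambda>m. z ^ m / real (Suc m)) sums (- ln (1 - z) / z)"
    using assms by (simp del: of_nat_Suc)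
  show "z ^ m / real (Suc m) powi k \<le> z ^ m / real (Suc m)" for m
    using assms power_int_increasing[of 1 k "real (Suc m)"]
    by (intro divide_left_mono) auto
qed

text \<open>The right-hand side is the product of the \<open>p\<close> numbers from
  \<open>m + 1\<close> to \<open>m + p\<close>.\<close>

lemma Suc_power_le_fact_binomial: "Suc m ^ p \<le> fact p * ((m + p) choose p)"
proof (induction p)
  case (Suc p)
  have "Suc m ^ Suc p \<le> Suc (m + p) * (fact p * ((m + p) choose p))"
    using mult_mono[OF _ Suc, of "Suc m" "Suc (m + p)"] by simp
  also have "\<dots> = fact p * (Suc (m + p) * ((m + p) choose p))" by (simp only: mult.left_commute)
  also have "\<dots> = fact p * ((Suc (m + p) choose Suc p) * Suc p)"
    by (simp only: Suc_times_binomial_eq)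
  finally show ?case by (simp only: fact_Suc of_nat_id add_Suc_right mult_ac)
qed auto

text \<open>Termwise comparison with the binomial series of \<open>(1 - z) powr (- (p + 1))\<close>,
  whose coefficients are \<open>(m + p) choose p\<close>.\<close>

lemma eval_polylog_quot_le_powr:
  fixes z :: real
  assumes "0 \<le> z" "z < 1"
  shows "eval_fps (polylog_quot_fps (- int p)) z \<le> fact p * (1 - z) powr (- (real p + 1))"
proof (rule sums_le)
  show "(\<lambda>m. z ^ m / real (Suc m) powi (- int p)) sums eval_fps (polylog_quot_fps (- int p)) z"
    using polylog_quot_sums[of z "- int p"] assms by simp
  have "(\<lambda>m. ((- (real p + 1)) gchoose m) * (- z) ^ m) sums (1 + - z) powr (- (real p + 1))"
    by (rule gen_binomial_real) (use assms in auto)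
  moreover have "((- (real p + 1)) gchoose m) * (- z) ^ m = real ((m + p) choose p) * z ^ m" for m
  proof -
    \<comment> \<open>Upper negation; its sign cancels against the one in
      \<open>(- z) ^ m\<close>.\<close>
    have "((- (real p + 1)) gchoose m) = (- 1) ^ m * (real (m + p) gchoose m)"
      unfolding gbinomial_minus by (simp add: add.commute)
    also have "real (m + p) gchoose m = real ((m + p) choose p)"
      using binomial_symmetric[of m "m + p"] by (simp only: binomial_gbinomial[symmetric]) simp
    finally show ?thesis by (simp flip: power_mult_distrib)
  qed
  ultimately show "(\<lambda>m. fact p * (real ((m + p) choose p) * z ^ m)) sums (fact p * (1 - z) powr (- (real p + 1)))"
    by (intro sums_mult) simp
  show "z ^ m / real (Suc m) powi (- int p) \<le> fact p * (real ((m + p) choose p) * z ^ m)" for m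
  proof -
    have "real (Suc m ^ p) \<le> real (fact p * ((m + p) choose p))"
      by (rule of_nat_mono[OF Suc_power_le_fact_binomial])
    hence "z ^ m * real (Suc m) ^ p \<le> z ^ m * (fact p * real ((m + p) choose p))"
      using assms by (intro mult_left_mono) auto
    thus ?thesis by (simp add: power_int_minus divide_inverse mult_ac del: of_nat_Suc)
  qed
qed

text \<open>With \<open>z = 1 - exp (- c * t)\<close> the logarithmic bound grows only linearly in
  \<open>t\<close>, so half of the exponent \<open>y\<close> absorbs it. For
  \<open>k \<le> 0\<close> the power bound is \<open>exp ((\<bar>k\<bar> + 1) * c * t)\<close> up to
  a constant, which the assumption on \<open>y\<close> outweighs.\<close>

lemma polylog_quot_exp_decay:
  fixes c y :: real and k :: int
  assumes "c > 0" "k \<ge> 1 \<Longrightarrow> y > 0" "k \<le> 0 \<Longrightarrow> y > (of_int \<bar>k\<bar> + 1) * c"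
  shows "\<exists>\<epsilon> C. \<epsilon> > 0 \<and> (\<forall>t>0.
    exp (- y * t) * eval_fps (polylog_quot_fps k) (1 - exp (- c * t)) \<le> C * exp (- \<epsilon> * t))"
proof (cases "k \<ge> 1")
  case True
  with assms have y: "y > 0" by simp
  \<comment> \<open>Chosen so that \<open>1 + c * t \<le> C * (1 + y / 2 * t)\<close>, coefficient
    by coefficient.\<close>
  define C where "C = max 1 (2 * c / y)"
  have "exp (- y * t) * eval_fps (polylog_quot_fps k) (1 - exp (- c * t)) \<le> C * exp (- (y / 2) * t)"
    if t: "t > 0" for t
  proof -
    have ct: "c * t > 0" using assms t by simp
    have "eval_fps (polylog_quot_fps k) (1 - exp (- c * t)) \<le> - ln (1 - (1 - exp (- c * t))) / (1 - exp (- c * t))"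
      using ct True by (intro eval_polylog_quot_le_ln) auto
    also have "\<dots> = c * t / (1 - exp (- c * t))" by simp
    \<comment> \<open>Cleared of the denominator, this says
      \<open>exp (- c * t) * (1 + c * t) \<le> 1\<close>.\<close>
    also have "\<dots> \<le> 1 + c * t"
    proof -
      have "exp (- c * t) * (1 + c * t) \<le> exp (- c * t) * exp (c * t)"
        by (intro mult_left_mono exp_ge_add_one_self) auto
      also have "\<dots> = 1" by (simp flip: exp_add)
      finally show ?thesis using ct by (simp add: divide_le_eq algebra_simps)
    qed
    also have "\<dots> \<le> C * (1 + y / 2 * t)"
    proof -
      have "c \<le> C * (y / 2)"
        using mult_right_mono[OF max.cobounded2[of "2 * c / y" 1], of "y / 2"] y by (simp add: C_def)
      from mult_right_mono[OF this, of t] t have "c * t \<le> C * (y / 2) * t" by simp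
      moreover have "1 \<le> C" by (simp add: C_def)
      ultimately show ?thesis by (simp add: algebra_simps)
    qed
    also have "\<dots> \<le> C * exp (y / 2 * t)"
      by (intro mult_left_mono exp_ge_add_one_self) (auto simp: C_def)
    finally have "exp (- y * t) * eval_fps (polylog_quot_fps k) (1 - exp (- c * t)) \<le>
                    exp (- y * t) * (C * exp (y / 2 * t))"
      by (rule mult_left_mono) auto
    also have "\<dots> = C * exp (- (y / 2) * t)" by (simp add: mult_ac flip: exp_add)
    finally show ?thesis .
  qed
  thus ?thesis using y by (intro exI[of _ "y / 2"] exI[of _ C]) auto
next
  case False
  define p where "p = nat (- k)"
  have k: "k = - int p" using False by (simp add: p_def)
  have "exp (- y * t) * eval_fps (polylog_quot_fps k) (1 - exp (- c * t)) \<le>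
          fact p * exp (- (y - (real p + 1) * c) * t)" if t: "t > 0" for t
  proof -
    have "eval_fps (polylog_quot_fps k) (1 - exp (- c * t)) \<le>
            fact p * (1 - (1 - exp (- c * t))) powr (- (real p + 1))"
      unfolding k using assms t by (intro eval_polylog_quot_le_powr) auto
    hence "exp (- y * t) * eval_fps (polylog_quot_fps k) (1 - exp (- c * t)) \<le>
             exp (- y * t) * (fact p * exp ((real p + 1) * c * t))"
      by (intro mult_left_mono) (auto simp: powr_def algebra_simps)
    also have "\<dots> = fact p * exp (- (y - (real p + 1) * c) * t)"
      by (simp add: algebra_simps flip: exp_add)
    finally show ?thesis .
  qed
  moreover have "y - (real p + 1) * c > 0" using assms(3) False by (simp add: k)
  ultimately show ?thesis by blast
qed

section \<open>Generating function and integrand after cancelling the common zero\<close>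

lemma poly_bernoulli_gf_conv_quot:
  fixes a b x :: real
  assumes "a > 0" "b > 0" "a * b > 1"
  shows "poly_bernoulli_gf k (- x) a b =
           fps_exp (- (x + ln b)) * (polylog_quot_fps k oo (1 - fps_exp (- ln (a * b))))"
proof -
  define U :: "real fps" where "U = 1 - fps_exp (- ln (a * b))"
  define D :: "real fps" where "D = fps_exp (ln b) - fps_exp (- ln a)"
  have "ln (a * b) > 0" using assms by (simp add: ln_gt_zero)
  hence "fps_nth U 1 \<noteq> 0" by (simp add: U_def)
  hence U: "U \<noteq> 0" by auto
  have U0: "fps_nth U 0 = 0" by (simp add: U_def)
  \<comment> \<open>The denominator is a unit times \<open>U\<close>, and \<open>U\<close> also
    divides the numerator. It is nonzero because its linear coefficient is
    \<open>ln (a * b)\<close>.\<close>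
  have D_eq: "D = fps_exp (ln b) * U"
    using assms by (simp add: D_def U_def algebra_simps ln_mult flip: fps_exp_add_mult)
  have inv: "fps_exp (- ln b) * fps_exp (ln b) = (1 :: real fps)" by (simp flip: fps_exp_add_mult)
  hence "D \<noteq> 0" using U by (auto simp: D_eq)
  have "polylog_fps k oo U = U * (polylog_quot_fps k oo U)"
    using U0 by (simp add: polylog_fps_conv_quot fps_compose_mult_distrib fps_X_fps_compose_startby0)
  also have "\<dots> = (fps_exp (- ln b) * fps_exp (ln b)) * (U * (polylog_quot_fps k oo U))"
    by (simp only: inv mult_1_left)
  also have "\<dots> = (fps_exp (- ln b) * (polylog_quot_fps k oo U)) * D"
    by (simp only: D_eq mult_ac)
  finally have "(polylog_fps k oo U) / D = fps_exp (- ln b) * (polylog_quot_fps k oo U)"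
    using \<open>D \<noteq> 0\<close> by simp
  moreover have "fps_exp (- (x + ln b)) = fps_exp (- ln b) * fps_exp (- x)"
    by (simp flip: fps_exp_add_mult)
  ultimately show ?thesis
    by (simp only: poly_bernoulli_gf_def flip: U_def D_def) (simp only: mult_ac)
qed

text \<open>The function is analytic at 0, since \<open>1 - exp (- c * z)\<close> vanishes there and
  the quotient series has positive radius. The expansion is found for complex \<open>z\<close> and
  then read on the real axis.\<close>

lemma polylog_quot_exp_sums:
  fixes c y :: real and k :: int
  assumes "c > 0"
  defines "P \<equiv> fps_exp (- y) * (polylog_quot_fps k oo (1 - fps_exp (- c))) :: real fps"
  shows "\<exists>r>0. summable (\<lambda>n. \<bar>fps_nth P n\<bar> * r ^ n) \<and> (\<forall>t. 0 < t \<longrightarrow> t < r \<longrightarrow>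
    (\<lambda>n. fps_nth P n * t ^ n) sums (exp (- y * t) * eval_fps (polylog_quot_fps k) (1 - exp (- c * t))))"
proof -
  define H :: "complex \<Rightarrow> complex" where
    "H = (\<lambda>z. exp (of_real (- y) * z) * (eval_fps (polylog_quot_fps k) \<circ> (\<lambda>z. 1 - exp (of_real (- c) * z))) z)"
  have "H has_fps_expansion
          fps_exp (of_real (- y)) * (polylog_quot_fps k oo (1 - fps_exp (of_real (- c))))"
    unfolding H_def
    by (intro has_fps_expansion_mult has_fps_expansion_compose has_fps_expansion_diff
              has_fps_expansion_exp has_fps_expansion_1 eval_fps_has_fps_expansion)
       (auto simp: conv_radius_polylog_quot)
  hence "H has_fps_expansion fps_of_real P"
    by (simp add: P_def fps_of_real_mult fps_of_real_compose fps_of_real_diff fps_of_real_exp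
          fps_of_real_polylog_quot)
  hence rad: "fps_conv_radius (fps_of_real P :: complex fps) > 0"
    and "\<forall>\<^sub>F z in nhds 0. eval_fps (fps_of_real P) z = H z"
    by (auto simp: has_fps_expansion_def)
  then obtain d where d: "d > 0" "\<And>z. norm z < d \<Longrightarrow> eval_fps (fps_of_real P) z = H z"
    by (auto simp: eventually_nhds_metric)
  obtain e where e: "e > 0" "ereal e < fps_conv_radius (fps_of_real P :: complex fps)"
    using ereal_dense2[OF rad] by auto
  \<comment> \<open>Below \<open>d\<close> the series represents \<open>H\<close>; \<open>e\<close>
    lies strictly inside the radius of convergence, so the series converges absolutely even at
    \<open>r\<close>.\<close>
  define r where "r = min d e"
  have r: "r > 0" using d e by (simp add: r_def)
  have "ereal r \<le> ereal e" by (simp add: r_def)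
  hence rr: "ereal r < fps_conv_radius (fps_of_real P :: complex fps)"
    using e(2) by (rule le_less_trans)
  have "(\<lambda>n. fps_nth P n * t ^ n) sums (exp (- y * t) * eval_fps (polylog_quot_fps k) (1 - exp (- c * t)))"
    if t: "0 < t" "t < r" for t
  proof -
    have "ereal (norm (complex_of_real t)) < fps_conv_radius (fps_of_real P :: complex fps)"
      using t by (intro order.strict_trans[OF _ rr]) simp
    hence "(\<lambda>n. fps_nth (fps_of_real P) n * complex_of_real t ^ n) sums eval_fps (fps_of_real P) (of_real t)"
      by (rule sums_eval_fps)
    also have "eval_fps (fps_of_real P) (of_real t) = H (of_real t)"
      using t by (intro d) (simp add: r_def)
    also have "\<dots> = of_real (exp (- y * t)) * eval_fps (polylog_quot_fps k) (of_real (1 - exp (- c * t)))"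
      by (simp add: H_def flip: exp_of_real)
    also have "\<dots> = of_real (exp (- y * t) * eval_fps (polylog_quot_fps k) (1 - exp (- c * t)))"
      using t assms by (subst eval_polylog_quot_of_real) auto
    finally have "(\<lambda>n. complex_of_real (fps_nth P n * t ^ n)) sums
        of_real (exp (- y * t) * eval_fps (polylog_quot_fps k) (1 - exp (- c * t)))" by simp
    thus ?thesis by (simp only: sums_of_real_iff)
  qed
  moreover have "summable (\<lambda>n. \<bar>fps_nth P n\<bar> * r ^ n)"
    using norm_summable_fps[of "complex_of_real r" "fps_of_real P"] rr r
    by (simp add: norm_mult norm_power)
  ultimately show ?thesis using r by blast
qed

text \<open>The same cancellation for actual values: the denominator is
  \<open>exp (ln b * t) * w\<close>, where \<open>0 < w < 1\<close>, so that \<open>w\<close> can be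
  divided out and the polylogarithm series converges.\<close>

lemma arakawa_kaneko_integrand_conv_quot:
  fixes a b x t :: real
  assumes "a > 0" "b > 0" "a * b > 1" "t > 0"
  shows "arakawa_kaneko_integrand k s x a b t =
           of_real (exp (- (x + ln b) * t) * eval_fps (polylog_quot_fps k) (1 - exp (- ln (a * b) * t)))
             * of_real t powr (s - 1)"
proof -
  define w where "w = 1 - exp (- ln (a * b) * t)"
  have "ln (a * b) * t > 0" using assms by (simp add: ln_gt_zero)
  hence w: "0 < w" "w < 1" by (simp_all add: w_def)
  have "(a * b) powr (- t) = 1 - w"
    using assms by (simp add: w_def powr_def mult_ac)
  moreover have "b powr t - a powr (- t) = exp (ln b * t) * w"
    using assms by (simp add: w_def powr_def ln_mult algebra_simps flip: exp_add)
  ultimately have "polylog k (1 - (a * b) powr (- t)) / (b powr t - a powr (- t)) * exp (- x * t) =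
          eval_fps (polylog_quot_fps k) w * (exp (- x * t) / exp (ln b * t))"
    using w by (simp add: polylog_conv_quot)
  also have "exp (- x * t) / exp (ln b * t) = exp (- (x + ln b) * t)"
    by (simp add: algebra_simps flip: exp_diff)
  finally show ?thesis
    by (simp add: arakawa_kaneko_integrand_def w_def mult.commute)
qed

section \<open>Application to the Arakawa-Kaneko zeta function\<close>

theorem theorem4p2:
  fixes a b x :: real and k :: int
  assumes "a > 0" and "b > 0"
    and "k \<ge> 1 \<Longrightarrow> x > 0"
    and "k \<le> 0 \<Longrightarrow> x > of_int \<bar>k\<bar> + 1"
    and "a * b > 1"
    and "k \<ge> 1 \<Longrightarrow> x + ln b > 0"
    and "k \<le> 0 \<Longrightarrow> x + ln b > (of_int \<bar>k\<bar> + 1) * ln (a * b)"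
  shows "\<exists>\<xi>. \<xi> holomorphic_on UNIV \<and>
    (\<forall>s. Re s > 0 \<longrightarrow>
       set_integrable lborel {0<..} (arakawa_kaneko_integrand k s x a b) \<and>
       \<xi> s = arakawa_kaneko_zeta k s x a b) \<and>
    (\<forall>n::nat. n \<ge> 1 \<longrightarrow>
       \<xi> (- of_nat n) = of_real ((- 1) ^ n * poly_bernoulli k n (- x) a b))"
proof -
  define y c where "y = x + ln b" and "c = ln (a * b)"
  define E where "E = (\<lambda>t. exp (- y * t) * eval_fps (polylog_quot_fps k) (1 - exp (- c * t)))"
  define P :: "real fps" where "P = fps_exp (- y) * (polylog_quot_fps k oo (1 - fps_exp (- c)))"
  have c: "c > 0" using assms(5) by (simp add: c_def ln_gt_zero)
  have y: "k \<ge> 1 \<Longrightarrow> y > 0" "k \<le> 0 \<Longrightarrow> y > (of_int \<bar>k\<bar> + 1) * c"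
    using assms(6,7) by (simp_all only: y_def c_def)
  have "\<exists>\<epsilon> C. \<epsilon> > 0 \<and> (\<forall>t>0. E t \<le> C * exp (- \<epsilon> * t))"
    unfolding E_def using c y by (rule polylog_quot_exp_decay)
  then obtain \<epsilon> C where eps: "\<epsilon> > 0" and decay: "\<And>t. t > 0 \<Longrightarrow> E t \<le> C * exp (- \<epsilon> * t)"
    by blast
  have "\<exists>r>0. summable (\<lambda>n. \<bar>fps_nth P n\<bar> * r ^ n) \<and>
          (\<forall>t. 0 < t \<longrightarrow> t < r \<longrightarrow> (\<lambda>n. fps_nth P n * t ^ n) sums E t)"
    unfolding E_def P_def using c by (rule polylog_quot_exp_sums)
  then obtain r where r: "r > 0" "summable (\<lambda>n. \<bar>fps_nth P n\<bar> * r ^ n)"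
    and sums: "\<And>t. 0 < t \<Longrightarrow> t < r \<Longrightarrow> (\<lambda>n. fps_nth P n * t ^ n) sums E t"
    by blast
  interpret mellin "\<lambda>t. complex_of_real (E t)" "\<lambda>n. complex_of_real (fps_nth P n)" C \<epsilon> r
  proof
    show "continuous_on {0<..} (\<lambda>t. complex_of_real (E t))"
      unfolding E_def using c by (intro continuous_intros) (auto simp: conv_radius_polylog_quot)
    show "norm (complex_of_real (E t)) \<le> C * exp (- \<epsilon> * t)" if "t > 0" for t
    proof -
      \<comment> \<open>Nonnegativity turns the upper bound \<open>decay\<close> into a bound on the
        norm.\<close>
      have "E t \<ge> 0"
        unfolding E_def using c that by (intro mult_nonneg_nonneg eval_polylog_quot_nonneg) auto
      thus ?thesis using decay[OF that] by simp
    qed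
    show "(\<lambda>n. of_real (fps_nth P n) * of_real t ^ n) sums complex_of_real (E t)" if "0 < t" "t < r" for t
      using sums_of_real[where 'a = complex, OF sums[OF that]] by simp
  qed (use eps r in auto)
  have integrand: "arakawa_kaneko_integrand k s x a b t = of_real (E t) * of_real t powr (s - 1)"
    if "t \<in> {0<..}" for s t
    using arakawa_kaneko_integrand_conv_quot[of a b t] assms that unfolding E_def y_def c_def by simp
  have integrable: "set_integrable lborel {0<..} (arakawa_kaneko_integrand k s x a b)" if "Re s > 0" for s
    using integrand_integrable[OF that] by (subst set_integrable_cong[OF refl refl integrand]) auto
  have zeta: "arakawa_kaneko_zeta k s x a b = rGamma s * (LBINT t:{0<..}. of_real (E t) * of_real t powr (s - 1))" for s
  proof -
    have "(LBINT t:{0<..}. arakawa_kaneko_integrand k s x a b t) =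
            (LBINT t:{0<..}. of_real (E t) * of_real t powr (s - 1))"
      by (rule set_lebesgue_integral_cong) (auto intro: integrand)
    \<comment> \<open>\<open>rGamma s = inverse (Gamma s)\<close> holds for every \<open>s\<close>;
      at the poles of Gamma both sides are 0.\<close>
    thus ?thesis by (simp add: arakawa_kaneko_zeta_def rGamma_inverse_Gamma divide_inverse)
  qed
  have bernoulli: "poly_bernoulli k n (- x) a b = fact n * fps_nth P n" for n
    using poly_bernoulli_gf_conv_quot[of a b k x] assms by (simp add: poly_bernoulli_def P_def y_def c_def)
  from continuation obtain \<xi> where "\<xi> holomorphic_on UNIV"
      "\<And>s. Re s > 0 \<Longrightarrow> \<xi> s = rGamma s * (LBINT t:{0<..}. of_real (E t) * of_real t powr (s - 1))"
      "\<And>n. \<xi> (- of_nat n) = (- 1) ^ n * fact n * of_real (fps_nth P n)"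
    by metis
  thus ?thesis
    by (intro exI[of _ \<xi>]) (simp add: integrable zeta bernoulli)
qed

end
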